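(* Let $0<\alpha<1$, $h>0$, and $\ell_{\alpha,h}^2:=\Gamma(2-\alpha)h^\alpha$ with $\ell_{\alpha,h}>0$. Let $L\in\mathbb{R}^{M\times M}$ be a graph or finite-difference Laplacian matrix with $L\mathbf 1=0$. Assume that $I+\ell_{\alpha,h}^2L$ is invertible and that $$\|(I+\ell_{\alpha,h}^2L)^{-1}g\|_{\ell^\infty}\le\|g\|_{\ell^\infty}\qquad\text{for all }g\in\mathbb{R}^M .$$ Let $n\ge2$, let $\chi^0,\dots,\chi^{n-1}\in\{0,1\}^M$ with L1 history average $\bar\chi^{\,n-1}$, and suppose that $\chi^{n-1}=\chi^{n-2}=\cdots=\chi^{n-q}$ for some $1\le q\le n-1$. Let $w^n=(I+\ell_{\alpha,h}^2L)^{-1}\bar\chi^{\,n-1}$. If $$b_q+\ell_{\alpha,h}^2\|L\chi^{n-1}\|_{\ell^\infty}<\frac12 ,$$ then the next thresholding step is pinned, that is, $\mathbf 1_{\{w^n_i>1/2\}}=\chi^{n-1}_i$ for every $i=1,\dots,M$.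
   Context: $\Gamma$ is the Gamma function. L1 weights: $b_k:=(k+1)^{1-\alpha}-k^{1-\alpha}$ for $k\ge0$. L1 history average: $$\bar\chi^{\,n-1}:=\sum_{j=1}^{n-1}(b_{j-1}-b_j)\,\chi^{n-j}+b_{n-1}\chi^0 .$$ $\mathbf 1\in\mathbb{R}^M$ denotes the all-ones vector in the condition $L\mathbf 1=0$; $\mathbf 1_{\{s>1/2\}}$ equals $1$ if $s>1/2$ and $0$ otherwise. $\|g\|_{\ell^\infty}=\max_i|g_i|$. The sign convention is that $L$ is a discretization of $-\Delta$, so $I+\ell^2L$ is the discrete analogue of $I-\ell^2\Delta$. The only properties required of $L$ are that it is a real $M\times M$ matrix with $L\mathbf 1=0$ and that the stated resolvent contraction holds. *)

theory Defs
  imports "HOL-Analysis.Analysis"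
begin

definition l1_weight :: "real \<Rightarrow> nat \<Rightarrow> real" where
  "l1_weight \<alpha> k = (real k + 1) powr (1 - \<alpha>) - real k powr (1 - \<alpha>)"

text \<open>The second argument \<open>n\<close> is the index of the step being computed: \<open>l1_history \<alpha> n X\<close> is
  the average with superscript \<open>n - 1\<close>, formed from \<open>X 0, \<dots>, X (n - 1)\<close>. It is meant for \<open>n \<ge> 1\<close>.\<close>

definition l1_history :: "real \<Rightarrow> nat \<Rightarrow> (nat \<Rightarrow> real ^ 'm) \<Rightarrow> real ^ 'm" where
  "l1_history \<alpha> n X =
     (\<Sum>j = 1..n - 1. (l1_weight \<alpha> (j - 1) - l1_weight \<alpha> j) *\<^sub>R X (n - j))
       + l1_weight \<alpha> (n - 1) *\<^sub>R X 0"

end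

theory Submission
  imports Defs
begin

text \<open>Writing \<open>R\<close> for the resolvent and \<open>x\<close> for the last state, \<open>w - x = R (H - x - \<ell>\<^sup>2 L x)\<close>,
  where \<open>H\<close> is the history average. The weights in \<open>H\<close> are nonnegative and sum to one, and those
  of states other than the last \<open>q\<close> have total mass \<open>b\<^sub>q\<close>; hence \<open>H - x\<close> is at most \<open>b\<^sub>q\<close> in the
  maximum norm. Contractivity of \<open>R\<close> then puts \<open>w\<close> within less than one half of \<open>x\<close>.\<close>

text \<open>The mean value theorem for \<open>x powr (1 - \<alpha>)\<close> on an interval of length
  one. The intermediate points lie strictly inside intervals that do not overlap for different
  \<open>k\<close>, so weights can be compared through them.\<close>

lemma l1_weight_mean_value:
  assumes "\<alpha> < 1"
  obtains z where "real k < z" "z < real k + 1" "l1_weight \<alpha> k = (1 - \<alpha>) * z powr (- \<alpha>)"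
proof -
  have "\<exists>l z. real k < z \<and> z < real k + 1 \<and> ((\<lambda>x. x powr (1 - \<alpha>)) has_real_derivative l) (at z) \<and>
      (real k + 1) powr (1 - \<alpha>) - real k powr (1 - \<alpha>) = (real k + 1 - real k) * l"
  proof (rule MVT)
    \<comment> \<open>For \<open>k = 0\<close> the interval contains 0, where the power is
      continuous because the exponent is positive; differentiability is claimed only in the
      interior.\<close>
    show "continuous_on {real k..real k + 1} (\<lambda>x. x powr (1 - \<alpha>))"
      using assms by (intro continuous_on_powr') (auto intro!: continuous_intros)
    show "(\<lambda>x. x powr (1 - \<alpha>)) differentiable at x" if "real k < x" "x < real k + 1" for x
      using has_real_derivative_powr[of x "1 - \<alpha>"] that real_differentiable_def by fastforce
  qed simp
  then obtain l z where z: "real k < z" "z < real k + 1"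
    and l: "((\<lambda>x. x powr (1 - \<alpha>)) has_real_derivative l) (at z)" "l1_weight \<alpha> k = l"
    by (auto simp: l1_weight_def)
  have "l = (1 - \<alpha>) * z powr (1 - \<alpha> - 1)"
    using DERIV_unique[OF l(1) has_real_derivative_powr] z by simp
  with z l(2) show ?thesis
    by (intro that) auto
qed

text \<open>The intermediate points satisfy \<open>y < k + 1 < z\<close>, and
  \<open>t powr (- \<alpha>)\<close> does not increase for positive \<open>t\<close>.\<close>

lemma decseq_l1_weight:
  assumes "0 \<le> \<alpha>" "\<alpha> < 1"
  shows "decseq (l1_weight \<alpha>)"
proof (rule decseq_SucI)
  fix k
  obtain y where y: "real k < y" "y < real k + 1" "l1_weight \<alpha> k = (1 - \<alpha>) * y powr (- \<alpha>)"
    using assms(2) by (rule l1_weight_mean_value)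
  obtain z where z: "real (Suc k) < z" "l1_weight \<alpha> (Suc k) = (1 - \<alpha>) * z powr (- \<alpha>)"
    using assms(2) by (rule l1_weight_mean_value)
  have "z powr (- \<alpha>) \<le> y powr (- \<alpha>)"
    using y z assms by (intro powr_mono2') auto
  then show "l1_weight \<alpha> (Suc k) \<le> l1_weight \<alpha> k"
    using y z assms by (simp add: mult_left_mono)
qed

lemma l1_weight_nonneg:
  assumes "\<alpha> \<le> 1"
  shows "0 \<le> l1_weight \<alpha> k"
  using assms by (simp add: l1_weight_def powr_mono2)

text \<open>\<open>0 powr a\<close> is 0 for every \<open>a\<close>, even \<open>a = 0\<close>, so
  this holds for all \<alpha>.\<close>

lemma l1_weight_0 [simp]: "l1_weight \<alpha> 0 = 1"
  by (simp add: l1_weight_def)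

lemma sum_l1_weight_diff:
  assumes "m \<le> n"
  shows "(\<Sum>j = Suc m..n. l1_weight \<alpha> (j - 1) - l1_weight \<alpha> j) = l1_weight \<alpha> m - l1_weight \<alpha> n"
  using sum_telescope''[OF assms, of "\<lambda>j. - l1_weight \<alpha> j"] by simp

text \<open>The differences telescope to \<open>1 - l1_weight \<alpha> (n - 1)\<close> and the
  weight of \<open>X 0\<close> supplies the rest, so \<open>x\<close> can be moved inside the
  average.\<close>

lemma l1_history_diff:
  "l1_history \<alpha> n X - x =
     (\<Sum>j = 1..n - 1. (l1_weight \<alpha> (j - 1) - l1_weight \<alpha> j) *\<^sub>R (X (n - j) - x))
       + l1_weight \<alpha> (n - 1) *\<^sub>R (X 0 - x)"
proof -
  have "(\<Sum>j = 1..n - 1. l1_weight \<alpha> (j - 1) - l1_weight \<alpha> j) = 1 - l1_weight \<alpha> (n - 1)"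
    using sum_l1_weight_diff[of 0 "n - 1" \<alpha>] by simp
  then have "(\<Sum>j = 1..n - 1. (l1_weight \<alpha> (j - 1) - l1_weight \<alpha> j) *\<^sub>R (X (n - j) - x)) =
      (\<Sum>j = 1..n - 1. (l1_weight \<alpha> (j - 1) - l1_weight \<alpha> j) *\<^sub>R X (n - j))
        - (1 - l1_weight \<alpha> (n - 1)) *\<^sub>R x"
    by (simp add: scaleR_diff_right sum_subtractf flip: scaleR_sum_left)
  then show ?thesis
    by (simp add: l1_history_def algebra_simps)
qed

lemma infnorm_le_cart:
  fixes x :: "real ^ 'm"
  assumes "\<And>i. \<bar>x $ i\<bar> \<le> B"
  shows "infnorm x \<le> B"
  unfolding infnorm_cart using assms by (intro cSup_least) auto

lemma infnorm_sum_le: "infnorm (sum f A) \<le> (\<Sum>a\<in>A. infnorm (f a))"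
proof (induction A rule: infinite_finite_induct)
  case (insert a A)
  then show ?case
    using infnorm_triangle[of "f a" "sum f A"] by simp
qed (simp_all add: infnorm_0)

lemma infnorm_l1_history_diff_le:
  assumes "0 \<le> \<alpha>" "\<alpha> < 1" and q: "q \<le> n - 1"
    and pinned: "\<And>j. j \<in> {1..q} \<Longrightarrow> X (n - j) = x"
    and diam: "\<And>k. k \<le> n - 1 \<Longrightarrow> infnorm (X k - x) \<le> 1"
  shows "infnorm (l1_history \<alpha> n X - x) \<le> l1_weight \<alpha> q"
proof -
  let ?c = "\<lambda>j. l1_weight \<alpha> (j - 1) - l1_weight \<alpha> j"
  have c: "0 \<le> ?c j" for j
    using decseqD[OF decseq_l1_weight[OF assms(1,2)], of "j - 1" j] by simp
  have scaled: "infnorm (a *\<^sub>R (X k - x)) \<le> a" if "0 \<le> a" "k \<le> n - 1" for a k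
    using mult_left_mono[OF diam[OF that(2)] that(1)] that(1) by (simp add: infnorm_mul)
  \<comment> \<open>The terms with \<open>j \<le> q\<close> vanish; the remaining coefficients
    telescope.\<close>
  have "(\<Sum>j = 1..n - 1. ?c j *\<^sub>R (X (n - j) - x)) = (\<Sum>j = Suc q..n - 1. ?c j *\<^sub>R (X (n - j) - x))"
    by (rule sum.mono_neutral_right) (use pinned in \<open>auto simp: not_less_eq_eq\<close>)
  also have "infnorm \<dots> \<le> (\<Sum>j = Suc q..n - 1. infnorm (?c j *\<^sub>R (X (n - j) - x)))"
    by (rule infnorm_sum_le)
  also have "\<dots> \<le> (\<Sum>j = Suc q..n - 1. ?c j)"
    by (intro sum_mono scaled c) auto
  also have "\<dots> = l1_weight \<alpha> q - l1_weight \<alpha> (n - 1)"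
    using q by (rule sum_l1_weight_diff)
  finally have "infnorm (\<Sum>j = 1..n - 1. ?c j *\<^sub>R (X (n - j) - x)) \<le> l1_weight \<alpha> q - l1_weight \<alpha> (n - 1)" .
  \<comment> \<open>The initial state contributes exactly the weight that the telescoped tail
    subtracts, which leaves \<open>l1_weight \<alpha> q\<close>.\<close>
  moreover have "infnorm (l1_weight \<alpha> (n - 1) *\<^sub>R (X 0 - x)) \<le> l1_weight \<alpha> (n - 1)"
    using assms(2) by (intro scaled l1_weight_nonneg) auto
  ultimately show ?thesis
    unfolding l1_history_diff
    using infnorm_triangle[of "\<Sum>j = 1..n - 1. ?c j *\<^sub>R (X (n - j) - x)"
        "l1_weight \<alpha> (n - 1) *\<^sub>R (X 0 - x)"] by linarith
qed

lemma infnorm_resolvent_diff_le: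
  fixes L :: "real ^ 'm ^ 'm"
  assumes "invertible (mat 1 + s *\<^sub>R L)"
    and "\<And>g. infnorm (matrix_inv (mat 1 + s *\<^sub>R L) *v g) \<le> infnorm g"
  shows "infnorm (matrix_inv (mat 1 + s *\<^sub>R L) *v g - x) \<le> infnorm (g - x) + \<bar>s\<bar> * infnorm (L *v x)"
proof -
  let ?A = "mat 1 + s *\<^sub>R L"
  \<comment> \<open>\<open>matrix_inv\<close> is a choice; invertibility makes the chosen matrix a
    genuine inverse.\<close>
  have "matrix_inv ?A ** ?A = mat 1"
    using assms(1) someI_ex[of "\<lambda>B. ?A ** B = mat 1 \<and> B ** ?A = mat 1"]
    by (simp add: invertible_def matrix_inv_def)
  then have "matrix_inv ?A *v (?A *v x) = x"
    by (simp only: matrix_vector_mul_assoc matrix_vector_mul_lid)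
  moreover have "?A *v x = x + s *\<^sub>R (L *v x)"
    by (simp add: matrix_vector_mult_add_rdistrib scaleR_matrix_vector_assoc)
  ultimately have "matrix_inv ?A *v (g - (x + s *\<^sub>R (L *v x))) = matrix_inv ?A *v g - x"
    by (simp only: matrix_vector_mult_diff_distrib)
  \<comment> \<open>Written as a sum with the scalar \<open>- s\<close>, so that the triangle
    inequality and \<open>infnorm_mul\<close> yield the factor \<open>\<bar>s\<bar>\<close>.\<close>
  then have "matrix_inv ?A *v g - x = matrix_inv ?A *v ((g - x) + (- s) *\<^sub>R (L *v x))"
    by (simp only: diff_diff_add scaleR_minus_left add_uminus_conv_diff)
  also have "infnorm \<dots> \<le> infnorm ((g - x) + (- s) *\<^sub>R (L *v x))"
    by (rule assms(2))
  also have "\<dots> \<le> infnorm (g - x) + infnorm ((- s) *\<^sub>R (L *v x))"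
    by (rule infnorm_triangle)
  finally show ?thesis
    by (simp only: infnorm_mul abs_minus_cancel)
qed

theorem mainTheorem6:
  fixes \<alpha> h ell :: real
    and L :: "real ^ 'm ^ 'm"
    and n q :: nat
    and X :: "nat \<Rightarrow> real ^ 'm"
    and w :: "real ^ 'm"
  assumes "0 < \<alpha>" and "\<alpha> < 1" and "0 < h"
    and "0 < ell" and "ell\<^sup>2 = Gamma (2 - \<alpha>) * h powr \<alpha>"
    and "L *v (\<chi> i. 1) = 0"
    and "invertible (mat 1 + ell\<^sup>2 *\<^sub>R L)"
    and "\<forall>g. infnorm (matrix_inv (mat 1 + ell\<^sup>2 *\<^sub>R L) *v g) \<le> infnorm g"
    and "2 \<le> n"
    and "\<forall>k\<le>n - 1. \<forall>i. X k $ i \<in> {0, 1}"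
    and "1 \<le> q" and "q \<le> n - 1"
    and "\<forall>j\<in>{1..q}. X (n - j) = X (n - 1)"
    and "w = matrix_inv (mat 1 + ell\<^sup>2 *\<^sub>R L) *v l1_history \<alpha> n X"
    and "l1_weight \<alpha> q + ell\<^sup>2 * infnorm (L *v X (n - 1)) < 1 / 2"
  shows "\<forall>i. (if w $ i > 1 / 2 then 1 else 0) = X (n - 1) $ i"
proof
  fix i
  let ?x = "X (n - 1)"
  have "infnorm (X k - ?x) \<le> 1" if "k \<le> n - 1" for k
  proof (rule infnorm_le_cart)
    fix j
    have "X k $ j \<in> {0, 1}" "?x $ j \<in> {0, 1}"
      using assms(10) that by blast+
    then show "\<bar>(X k - ?x) $ j\<bar> \<le> 1"
      by auto
  qed
  then have "infnorm (l1_history \<alpha> n X - ?x) \<le> l1_weight \<alpha> q"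
    using assms(1,2,12,13) by (intro infnorm_l1_history_diff_le) (blast intro: less_imp_le)+
  moreover have "infnorm (w - ?x) \<le> infnorm (l1_history \<alpha> n X - ?x) + ell\<^sup>2 * infnorm (L *v ?x)"
    using infnorm_resolvent_diff_le[OF assms(7), of "l1_history \<alpha> n X" ?x] assms(8,14) by simp
  \<comment> \<open>Strictness keeps \<open>w $ i\<close> off the threshold: it is below 1/2 when
    the old entry is 0 and above it when the entry is 1.\<close>
  ultimately have "\<bar>(w - ?x) $ i\<bar> < 1 / 2"
    using component_le_infnorm_cart[of "w - ?x" i] assms(15) by linarith
  moreover have "?x $ i \<in> {0, 1}"
    using assms(10) by blast
  ultimately show "(if w $ i > 1 / 2 then 1 else 0) = ?x $ i"
    by auto
qed

end
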